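(* Let $n\in\mathbb{N}$, let $E\subset\mathbb{R}^n$ be a nonempty set, let $\alpha>0$, and write $w(x)=\operatorname{dist}(x,E)^{-\alpha}$ for all $x\in\mathbb{R}^n$. If $w\in A_1$, then $E$ is weakly porous with constants $c,\delta$ depending only on $n$, $\alpha$ and $[w]_{A_1}$.
   Context: $\mathbb{N}=\{1,2,\dots\}$; $|\cdot|$ is $n$-dimensional Lebesgue measure; $\operatorname{dist}(x,E)$ is the Euclidean distance; $\operatorname{dist}(x,E)^{-\alpha}=+\infty$ where $\operatorname{dist}(x,E)=0$. Cubes: a cube is a half-open set $Q=[a_1,b_1)\times\cdots\times[a_n,b_n)$ with all sides of equal length $\ell(Q)=b_i-a_i>0$. For a cube $P$ and $j\ge 0$, $\mathcal{D}_j(P)$ is the collection of the $2^{jn}$ pairwise disjoint half-open cubes of side length $2^{-j}\ell(P)$ whose union is $P$, and $\mathcal{D}(P)=\bigcup_{j\ge0}\mathcal{D}_j(P)$. Weak porosity: let $E\subset\mathbb{R}^n$ be nonempty. A cube $Q\in\mathcal{D}(P)$ is $E$-free if $E\cap Q=\emptyset$. $\mathcal{M}(P)\in\mathcal{D}(P)$ denotes a (fixed choice of a) largest $E$-free dyadic subcube of $P$. $E$ is weakly porous with constants $0<c,\delta<1$ if for every cube $P\subset\mathbb{R}^n$ there exist $N\in\mathbb{N}$ and pairwise disjoint $E$-free cubes $Q_1,\dots,Q_N\in\mathcal{D}(P)$ with $|Q_k|\ge\delta|\mathcal{M}(P)|$ for all $k$ and $\sum_{k=1}^N|Q_k|\ge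 c|P|$ (in particular, every cube $P$ is required to have an $E$-free dyadic subcube). A weight is a locally integrable function $w$ on $\mathbb{R}^n$ with $w>0$ almost everywhere. A weight $w$ is in $A_1$ if there is a constant $C$ such that $\frac1{|Q|}\int_Q w\,dx\le C\operatorname{ess\,inf}_{Q}w$ for every cube $Q\subset\mathbb{R}^n$; the smallest such $C$ is denoted $[w]_{A_1}$. *)

theory Defs
  imports "HOL-Analysis.Analysis"
begin

definition cube :: "real^'n \<Rightarrow> real \<Rightarrow> (real^'n) set" where
  "cube a l = {x. \<forall>i. a $ i \<le> x $ i \<and> x $ i < a $ i + l}"

definition is_cube :: "(real^'n) set \<Rightarrow> bool" where
  "is_cube Q \<longleftrightarrow> (\<exists>a l. 0 < l \<and> Q = cube a l)"

definition dyadic_level :: "nat \<Rightarrow> (real^'n) set \<Rightarrow> (real^'n) set set" where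
  "dyadic_level j P =
     {Q. \<exists>a l. \<exists>m :: nat^'n. 0 < l \<and> P = cube a l \<and> (\<forall>i. m $ i < 2 ^ j) \<and>
           Q = cube (\<chi> i. a $ i + real (m $ i) * (l / 2 ^ j)) (l / 2 ^ j)}"

definition dyadic :: "(real^'n) set \<Rightarrow> (real^'n) set set" where
  "dyadic P = (\<Union>j. dyadic_level j P)"

definition free_dyadic :: "(real^'n) set \<Rightarrow> (real^'n) set \<Rightarrow> (real^'n) set set" where
  "free_dyadic E P = {Q \<in> dyadic P. E \<inter> Q = {}}"

(* Unspecified when P has no E-free dyadic subcube. *)
definition max_free :: "(real^'n) set \<Rightarrow> (real^'n) set \<Rightarrow> (real^'n) set" where
  "max_free E P =
     (SOME M. M \<in> free_dyadic E P \<and>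
        (\<forall>Q \<in> free_dyadic E P. measure lebesgue Q \<le> measure lebesgue M))"

(* N \<ge> 1 forces P to have an E-free dyadic subcube, so max_free E P is never
   the unspecified value where the definition holds. *)
definition weakly_porous :: "real \<Rightarrow> real \<Rightarrow> (real^'n) set \<Rightarrow> bool" where
  "weakly_porous c \<delta> E \<longleftrightarrow>
     0 < c \<and> c < 1 \<and> 0 < \<delta> \<and> \<delta> < 1 \<and>
     (\<forall>P. is_cube P \<longrightarrow>
        (\<exists>(N::nat) Q. 1 \<le> N \<and>
           (\<forall>k\<in>{1..N}. Q k \<in> free_dyadic E P) \<and>
           disjoint_family_on Q {1..N} \<and>
           (\<forall>k\<in>{1..N}. \<delta> * measure lebesgue (max_free E P) \<le> measure lebesgue (Q k)) \<and>
           c * measure lebesgue P \<le> (\<Sum>k=1..N. measure lebesgue (Q k))))"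

(* Weights take values in [0,\<infinity>], since powers of the distance to E are infinite on
   the closure of E. *)
definition weight :: "(real^'n \<Rightarrow> ennreal) \<Rightarrow> bool" where
  "weight w \<longleftrightarrow>
     w \<in> borel_measurable lebesgue \<and>
     (\<forall>K. compact K \<longrightarrow> (\<integral>\<^sup>+x\<in>K. w x \<partial>lebesgue) < \<infinity>) \<and>
     (AE x in lebesgue. 0 < w x)"

definition ess_inf_on :: "(real^'n) set \<Rightarrow> (real^'n \<Rightarrow> ennreal) \<Rightarrow> ennreal" where
  "ess_inf_on Q w = Sup {t. AE x in lebesgue. x \<in> Q \<longrightarrow> t \<le> w x}"

definition A1_bound :: "(real^'n \<Rightarrow> ennreal) \<Rightarrow> real \<Rightarrow> bool" where
  "A1_bound w C \<longleftrightarrow> 0 \<le> C \<and>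
     (\<forall>Q. is_cube Q \<longrightarrow>
        (\<integral>\<^sup>+x\<in>Q. w x \<partial>lebesgue) / emeasure lebesgue Q \<le> ennreal C * ess_inf_on Q w)"

definition A1 :: "(real^'n \<Rightarrow> ennreal) \<Rightarrow> bool" where
  "A1 w \<longleftrightarrow> weight w \<and> (\<exists>C. A1_bound w C)"

definition A1_const :: "(real^'n \<Rightarrow> ennreal) \<Rightarrow> real" where
  "A1_const w = Inf {C. A1_bound w C}"

definition dist_weight :: "real \<Rightarrow> (real^'n) set \<Rightarrow> real^'n \<Rightarrow> ennreal" where
  "dist_weight \<alpha> E x =
     (if infdist x E = 0 then \<infinity> else ennreal (infdist x E powr (- \<alpha>)))"


lemma cube_inject:
  fixes a b :: "real^'n"
  assumes "0 < l" "0 < k" "cube a l = cube b k"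
  shows "a = b \<and> l = k"
proof -
  have a: "a \<in> cube b k" and b: "b \<in> cube a l"
    using assms by (auto simp: cube_def set_eq_iff)
  have ab: "a = b"
    using a b by (auto simp: cube_def vec_eq_iff intro: antisym)
  define y where "y m = (\<chi> i. a $ i + m)" for m :: real
  have *: "y m \<in> cube a r \<longleftrightarrow> 0 \<le> m \<and> m < r" for m r
    by (auto simp: cube_def y_def)
  have "l \<le> k"
    using *[of k l] *[of k k] assms ab by auto
  moreover have "k \<le> l"
    using *[of l l] *[of l k] assms ab by auto
  ultimately show ?thesis using ab by simp
qed

lemma dyadic_level_cube:
  fixes a :: "real^'n"
  assumes "0 < l"
  shows "dyadic_level j (cube a l) =
    (\<lambda>m::nat^'n. cube (\<chi> i. a $ i + real (m $ i) * (l / 2 ^ j)) (l / 2 ^ j)) `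
      {m. \<forall>i. m $ i < 2 ^ j}"
  using assms cube_inject[OF assms] unfolding dyadic_level_def by blast

lemma Union_dyadic_level:
  fixes P :: "(real^'n) set"
  assumes "is_cube P"
  shows "\<Union>(dyadic_level j P) = P"
proof -
  obtain a l where l: "0 < l" and P: "P = cube a l"
    using assms by (auto simp: is_cube_def)
  define s where "s = l / 2 ^ j"
  have s: "0 < s" "l = 2 ^ j * s" using l by (auto simp: s_def)
  have 1: "x \<in> cube a l"
    if "\<forall>i. m $ i < 2 ^ j" and x: "x \<in> cube (\<chi> i. a $ i + real (m $ i) * s) s"
    for x and m :: "nat^'n"
  proof -
    have "a $ i \<le> x $ i \<and> x $ i < a $ i + l" for i
    proof -
      have "Suc (m $ i) \<le> 2 ^ j" using that by (simp add: Suc_leI)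
      hence "real (Suc (m $ i)) \<le> 2 ^ j"
        by (metis of_nat_le_iff of_nat_numeral of_nat_power)
      hence "real (Suc (m $ i)) * s \<le> l" using s by (simp add: mult_right_mono)
      moreover have "a $ i + real (m $ i) * s \<le> x $ i" "x $ i < a $ i + real (m $ i) * s + s"
        using x by (auto simp: cube_def)
      moreover have "0 \<le> real (m $ i) * s" using s by simp
      moreover have "real (Suc (m $ i)) * s = real (m $ i) * s + s" by (simp add: algebra_simps)
      ultimately show ?thesis by linarith
    qed
    thus ?thesis by (simp add: cube_def)
  qed
  have 2: "\<exists>m::nat^'n. (\<forall>i. m $ i < 2 ^ j) \<and> x \<in> cube (\<chi> i. a $ i + real (m $ i) * s) s"
    if x: "x \<in> cube a l" for x
  proof (intro exI conjI allI)
    define m :: "nat^'n" where "m = (\<chi> i. nat \<lfloor>(x $ i - a $ i) / s\<rfloor>)"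
    have nn: "0 \<le> (x $ i - a $ i) / s" "(x $ i - a $ i) / s < 2 ^ j" for i
      using x s by (auto simp: cube_def field_simps)
    show "m $ i < 2 ^ j" for i
      using nn[of i] by (simp add: m_def nat_less_iff floor_less_iff)
    have "a $ i + real (m $ i) * s \<le> x $ i \<and> x $ i < a $ i + real (m $ i) * s + s" for i
    proof -
      have r: "real (m $ i) = of_int \<lfloor>(x $ i - a $ i) / s\<rfloor>"
        using nn[of i] by (simp add: m_def)
      have "real (m $ i) \<le> (x $ i - a $ i) / s" "(x $ i - a $ i) / s < real (m $ i) + 1"
        unfolding r by linarith+
      thus ?thesis using s by (auto simp: field_simps)
    qed
    thus "x \<in> cube (\<chi> i. a $ i + real (m $ i) * s) s" by (simp add: cube_def)
  qed
  show ?thesis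
    unfolding P dyadic_level_cube[OF l] s_def[symmetric] using 1 2 by blast
qed

lemma dyadic_index_unique:
  fixes m m' :: "nat^'n"
  assumes s: "0 < s"
    and x: "x \<in> cube (\<chi> i. a $ i + real (m $ i) * s) s"
    and x': "x \<in> cube (\<chi> i. a $ i + real (m' $ i) * s) s"
  shows "m = m'"
proof -
  have "m $ i = m' $ i" for i
  proof -
    have "real (m $ i) * s < (real (m' $ i) + 1) * s"
      using x x' by (auto simp: cube_def algebra_simps dest!: spec[of _ i])
    moreover have "real (m' $ i) * s < (real (m $ i) + 1) * s"
      using x x' by (auto simp: cube_def algebra_simps dest!: spec[of _ i])
    ultimately show ?thesis using s by simp
  qed
  thus ?thesis by (simp add: vec_eq_iff)
qed

lemma disjoint_dyadic_level:
  fixes P :: "(real^'n) set"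
  assumes "is_cube P"
  shows "pairwise disjnt (dyadic_level j P)"
proof -
  obtain a l where l: "0 < l" and P: "P = cube a l"
    using assms by (auto simp: is_cube_def)
  show ?thesis
    unfolding P dyadic_level_cube[OF l] pairwise_def disjnt_def
    using dyadic_index_unique[where s = "l / 2 ^ j" and a = a] l
    by (auto simp del: times_divide_eq_right)
qed

lemma card_dyadic_level:
  fixes P :: "(real^'n) set"
  assumes "is_cube P"
  shows "card (dyadic_level j P) = 2 ^ (j * CARD('n))"
proof -
  obtain a l where l: "0 < l" and P: "P = cube a l"
    using assms by (auto simp: is_cube_def)
  have bij: "bij_betw vec_nth {m :: nat^'n. \<forall>i. m $ i < 2 ^ j} (PiE UNIV (\<lambda>_. {..<2 ^ j}))"
    by (rule bij_betw_byWitness[where f' = vec_lambda]) auto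
  have "inj_on (\<lambda>m::nat^'n. cube (\<chi> i. a $ i + real (m $ i) * (l / 2 ^ j)) (l / 2 ^ j))
          {m. \<forall>i. m $ i < 2 ^ j}"
  proof (rule inj_onI)
    fix m m' :: "nat^'n"
    assume *: "cube (\<chi> i. a $ i + real (m $ i) * (l / 2 ^ j)) (l / 2 ^ j) =
       cube (\<chi> i. a $ i + real (m' $ i) * (l / 2 ^ j)) (l / 2 ^ j)"
    have "0 < l / 2 ^ j" using l by simp
    hence "(\<chi> i. a $ i + real (m $ i) * (l / 2 ^ j)) =
        (\<chi> i. a $ i + real (m' $ i) * (l / 2 ^ j))"
      using cube_inject * by blast
    thus "m = m'" using l by (simp add: vec_eq_iff)
  qed
  hence "card (dyadic_level j P) = card {m :: nat^'n. \<forall>i. m $ i < 2 ^ j}"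
    unfolding P dyadic_level_cube[OF l] by (rule card_image)
  also have "\<dots> = (2 ^ j) ^ CARD('n)"
    using bij_betw_same_card[OF bij] by (simp add: card_PiE)
  finally show ?thesis by (simp add: power_mult)
qed

lemma measure_cube:
  fixes a :: "real^'n"
  assumes "0 < l"
  shows "measure lebesgue (cube a l) = l ^ CARD('n)"
    and "cube a l \<in> lmeasurable"
proof -
  let ?b = "\<chi> i. a $ i + l"
  have box: "box a ?b \<subseteq> cube a l" "cube a l \<subseteq> cbox a ?b"
    by (auto simp: cube_def mem_box_cart less_imp_le)
  have n: "negligible (cbox a ?b - box a ?b)"
    by (rule negligible_frontier_interval)
  have eq: "cube a l = cbox a ?b - (cbox a ?b - cube a l)" using box by blast
  have n2: "negligible (cbox a ?b - cube a l)"
    by (rule negligible_subset[OF n]) (use box in blast)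
  have sd: "negligible (sym_diff (cbox a ?b) (cube a l))"
    using n2 box by (simp add: Un_absorb2)
  show "cube a l \<in> lmeasurable"
    by (subst eq) (intro fmeasurable.Diff lmeasurable_cbox negligible_imp_measurable n2)
  have "measure lebesgue (cube a l) = measure lebesgue (cbox a ?b)"
    using measure_negligible_symdiff[OF lmeasurable_cbox sd] by simp
  also have "\<dots> = l ^ CARD('n)"
    using assms by (simp add: content_cbox_if_cart interval_eq_empty_cart not_less less_imp_le)
  finally show "measure lebesgue (cube a l) = l ^ CARD('n)" .
qed

lemma max_free:
  fixes P :: "(real^'n) set"
  assumes P: "is_cube P" and ne: "free_dyadic E P \<noteq> {}"
  shows "max_free E P \<in> free_dyadic E P"
    and "Q \<in> free_dyadic E P \<Longrightarrow> measure lebesgue Q \<le> measure lebesgue (max_free E P)"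
proof -
  obtain a l where l: "0 < l" and Pa: "P = cube a l"
    using P by (auto simp: is_cube_def)
  define J where "J = {j. \<exists>Q \<in> dyadic_level j P. E \<inter> Q = {}}"
  have "\<exists>j. j \<in> J" using ne by (auto simp: J_def free_dyadic_def dyadic_def)
  hence j: "(LEAST j. j \<in> J) \<in> J" by (metis LeastI)
  then obtain M where M: "M \<in> dyadic_level (LEAST j. j \<in> J) P" "E \<inter> M = {}"
    by (auto simp: J_def)
  have vol: "measure lebesgue Q = (l / 2 ^ j) ^ CARD('n)" if "Q \<in> dyadic_level j P" for Q j
    using that l unfolding Pa dyadic_level_cube[OF l] by (auto simp: measure_cube)
  have "M \<in> free_dyadic E P \<and>
     (\<forall>Q \<in> free_dyadic E P. measure lebesgue Q \<le> measure lebesgue M)"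
  proof (intro conjI ballI)
    show "M \<in> free_dyadic E P" using M by (auto simp: free_dyadic_def dyadic_def)
    fix Q assume "Q \<in> free_dyadic E P"
    then obtain i where i: "Q \<in> dyadic_level i P" "E \<inter> Q = {}"
      by (auto simp: free_dyadic_def dyadic_def)
    hence "i \<in> J" by (auto simp: J_def)
    hence "(LEAST j. j \<in> J) \<le> i" by (rule Least_le)
    hence "l / 2 ^ i \<le> l / 2 ^ (LEAST j. j \<in> J)"
      using l by (intro divide_left_mono) (auto intro: power_increasing)
    thus "measure lebesgue Q \<le> measure lebesgue M"
      using l unfolding vol[OF i(1)] vol[OF M(1)] by (intro power_mono) auto
  qed
  hence *: "max_free E P \<in> free_dyadic E P \<and>
     (\<forall>Q \<in> free_dyadic E P. measure lebesgue Q \<le> measure lebesgue (max_free E P))"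
    unfolding max_free_def by (rule someI)
  show "max_free E P \<in> free_dyadic E P" using * by blast
  show "Q \<in> free_dyadic E P \<Longrightarrow> measure lebesgue Q \<le> measure lebesgue (max_free E P)"
    using * by blast
qed

lemma A1_const_least:
  fixes w :: "real^'n \<Rightarrow> ennreal"
  assumes "A1 w"
  shows "A1_bound w (A1_const w)" and "A1_bound w C \<Longrightarrow> A1_const w \<le> C"
proof -
  let ?S = "{C. A1_bound w C}"
  have ne: "?S \<noteq> {}" using assms by (auto simp: A1_def)
  have bdd: "bdd_below ?S" by (rule bdd_belowI[of _ 0]) (simp add: A1_bound_def)
  show "A1_bound w C \<Longrightarrow> A1_const w \<le> C"
    unfolding A1_const_def using bdd by (simp add: cInf_lower)
  have nn: "0 \<le> A1_const w"
    unfolding A1_const_def using ne by (intro cInf_greatest) (auto simp: A1_bound_def)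
  obtain s where s: "\<And>k. s k \<in> ?S" "s \<longlonglongrightarrow> A1_const w"
  proof -
    have "\<exists>C\<in>?S. C < A1_const w + 1 / real (Suc k)" for k
      using cInf_lessD[OF ne, of "A1_const w + 1 / real (Suc k)"] by (auto simp: A1_const_def)
    then obtain s where s: "\<And>k. s k \<in> ?S" "\<And>k. s k < A1_const w + 1 / real (Suc k)"
      by metis
    have "s \<longlonglongrightarrow> A1_const w"
    proof (rule tendsto_sandwich)
      show "\<forall>\<^sub>F k in sequentially. A1_const w \<le> s k"
        using s(1) bdd unfolding A1_const_def by (intro always_eventually allI cInf_lower)
      show "\<forall>\<^sub>F k in sequentially. s k \<le> A1_const w + 1 / real (Suc k)"
        using s(2) by (intro always_eventually allI less_imp_le)
      show "(\<lambda>k. A1_const w + 1 / real (Suc k)) \<longlonglongrightarrow> A1_const w"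
        using tendsto_add[OF tendsto_const LIMSEQ_inverse_real_of_nat]
        by (simp add: inverse_eq_divide)
    qed simp
    thus ?thesis using s(1) that by blast
  qed
  have "(\<integral>\<^sup>+x\<in>Q. w x \<partial>lebesgue) / emeasure lebesgue Q
      \<le> ennreal (A1_const w) * ess_inf_on Q w" if Q: "is_cube Q" for Q
  proof (cases "ess_inf_on Q w = \<infinity>")
    case False
    have "(\<lambda>k. ennreal (s k) * ess_inf_on Q w) \<longlonglongrightarrow> ennreal (A1_const w) * ess_inf_on Q w"
      using False s(2) by (intro tendsto_mult_ennreal tendsto_ennrealI tendsto_const) auto
    thus ?thesis
      using s(1) Q by (intro LIMSEQ_le_const) (auto simp: A1_bound_def)
  next
    case True
    obtain a l where l: "0 < l" and Qa: "Q = cube a l" using Q by (auto simp: is_cube_def)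
    have wQ: "AE x in lebesgue. x \<in> Q \<longrightarrow> w x = \<infinity>"
    proof -
      have "AE x in lebesgue. x \<in> Q \<longrightarrow> ennreal (real k) \<le> w x" for k :: nat
      proof -
        have "ennreal (real k) < Sup {t. AE x in lebesgue. x \<in> Q \<longrightarrow> t \<le> w x}"
          using True unfolding ess_inf_on_def
          by (metis ennreal_less_top infinity_ennreal_def)
        then obtain t where t: "AE x in lebesgue. x \<in> Q \<longrightarrow> t \<le> w x" "ennreal (real k) < t"
          by (auto simp: less_Sup_iff)
        show ?thesis using t(1) by (rule eventually_mono) (use t(2) in auto)
      qed
      hence "AE x in lebesgue. \<forall>k. x \<in> Q \<longrightarrow> ennreal (real k) \<le> w x"
        unfolding AE_all_countable by blast
      thus ?thesis
      proof (rule eventually_mono, intro impI)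
        fix x assume *: "\<forall>k. x \<in> Q \<longrightarrow> ennreal (real k) \<le> w x" "x \<in> Q"
        show "w x = \<infinity>"
        proof (rule ccontr)
          assume "w x \<noteq> \<infinity>"
          then obtain k where "w x < of_nat k"
            using ennreal_Ex_less_of_nat by (metis infinity_ennreal_def less_top)
          thus False using * by (auto simp: ennreal_of_nat_eq_real_of_nat not_le[symmetric])
        qed
      qed
    qed
    let ?K = "cbox a (\<chi> i. a $ i + l)"
    have "Q \<subseteq> ?K" by (auto simp: Qa cube_def mem_box_cart less_imp_le)
    have "(\<integral>\<^sup>+x. \<infinity> * indicator Q x \<partial>lebesgue) = (\<integral>\<^sup>+x\<in>Q. w x \<partial>lebesgue)"
      using wQ by (intro nn_integral_cong_AE) (auto elim!: eventually_mono simp: indicator_def)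
    also have "\<dots> \<le> (\<integral>\<^sup>+x\<in>?K. w x \<partial>lebesgue)"
      using \<open>Q \<subseteq> ?K\<close> by (intro nn_integral_mono) (auto simp: indicator_def)
    also have "\<dots> < \<infinity>"
      using assms by (simp add: A1_def weight_def)
    finally have "\<infinity> * emeasure lebesgue Q < \<infinity>"
      using measure_cube(2)[OF l, of a] by (simp add: Qa fmeasurableD nn_integral_cmult_indicator)
    moreover have "0 < emeasure lebesgue Q"
      using measure_cube[OF l, of a] l by (simp add: Qa emeasure_eq_measure2)
    ultimately show ?thesis by (auto simp: ennreal_top_mult split: if_splits)
  qed
  thus "A1_bound w (A1_const w)" using nn by (simp add: A1_bound_def)
qed

end

theory Submission
  imports Defs
begin

text \<open>
  Let \<open>P\<close> be a cube and let \<open>r\<close> be the side of its largest \<open>E\<close>-free dyadic subcube \<open>M\<close>.  One such cube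
  exists, since otherwise \<open>E\<close> would be dense in \<open>P\<close> and the weight infinite on all of \<open>P\<close>
  (\<open>exists_free_dyadic\<close>).

  The \<open>A\<^sub>1\<close> condition bounds the average of the weight over \<open>P\<close> by \<open>C\<close> times its essential infimum, and \<open>M\<close> makes
  that infimum small: the central half of \<open>M\<close> keeps distance \<open>r / 4\<close> from \<open>E\<close>, so the average is
  at most \<open>C (r / 4)\<^sup>-\<^sup>\<alpha>\<close>.  The weight exceeds \<open>\<eta>\<^sup>-\<^sup>\<alpha>\<close> wherever the distance to \<open>E\<close> is below
  \<open>\<eta>\<close>.  By Chebyshev's inequality such points fill at most the fraction \<open>C (4 \<eta> / r)\<^sup>\<alpha>\<close> of \<open>P\<close>
  (\<open>measure_near_le\<close>).

  Take \<open>\<eta> = n s\<close> with \<open>s = r / 2\<^sup>k\<close>.  For \<open>k\<close> large, depending only on \<open>n\<close>, \<open>\<alpha>\<close> and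
  \<open>C\<close>, the fraction is at most one half.  Cut \<open>P\<close> into dyadic cubes of side \<open>s\<close>.  Two
  points of the same cube are less than \<open>n s\<close> apart, so every one that contains a point of the other half of \<open>P\<close> is \<open>E\<close>-free
  (\<open>free_cube_if_far_point\<close>).  These cubes have at least half the volume of \<open>P\<close>, and each has
  volume \<open>2\<^sup>-\<^sup>k\<^sup>n |M|\<close>.  Hence \<open>c = 1 / 2\<close> and \<open>\<delta> = 2\<^sup>-\<^sup>k\<^sup>n\<close> serve as constants of weak
  porosity.
\<close>

section \<open>Distance to a set and cubes free of it\<close>

text \<open>
  Two points of a half-open cube differ by less than \<open>s\<close> in each coordinate, so their distance is
  below \<open>n s\<close>.  This crude bound spares the square root of the dimension.
\<close>

lemma free_cube_if_far_point:
  fixes E :: "(real^'n) set"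
  assumes x: "x \<in> cube a s" and far: "real CARD('n) * s \<le> infdist x E"
  shows "E \<inter> cube a s = {}"
proof -
  have False if y: "y \<in> E" "y \<in> cube a s" for y
  proof -
    have "norm (x - y) \<le> (\<Sum>i\<in>UNIV. \<bar>(x - y) $ i\<bar>)" by (rule norm_le_l1_cart)
    also have "\<dots> < (\<Sum>i\<in>(UNIV :: 'n set). s)"
    proof (rule sum_strict_mono)
      fix i show "\<bar>(x - y) $ i\<bar> < s"
        using x y(2) by (auto simp: cube_def abs_less_iff dest!: spec[of _ i])
    qed auto
    finally have "dist x y < real CARD('n) * s" by (simp add: dist_norm)
    thus False using infdist_le[OF y(1), of x] far by linarith
  qed
  thus ?thesis by blast
qed

text \<open>
  A point outside a cube violates one of its coordinate bounds, and that coordinate alone already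
  separates it by \<open>r / 4\<close> from the concentric cube of half the side.
\<close>

lemma infdist_ge_on_core:
  fixes E :: "(real^'n) set"
  assumes ne: "E \<noteq> {}" and free: "E \<inter> cube b r = {}"
    and x: "x \<in> cube (\<chi> i. b $ i + r / 4) (r / 2)"
  shows "r / 4 \<le> infdist x E"
proof -
  have "r / 4 \<le> dist x y" if y: "y \<in> E" for y
  proof -
    have "y \<notin> cube b r" using y free by blast
    then obtain i where i: "y $ i < b $ i \<or> b $ i + r \<le> y $ i"
      by (auto simp: cube_def not_le not_less)
    have "b $ i + r / 4 \<le> x $ i" "x $ i < b $ i + r / 4 + r / 2"
      using x by (auto simp: cube_def)
    hence "r / 4 \<le> dist (x $ i) (y $ i)" using i by (auto simp: dist_real_def)
    also have "\<dots> \<le> dist x y" by (rule dist_vec_nth_le)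
    finally show ?thesis .
  qed
  thus ?thesis using ne unfolding infdist_notempty[OF ne] by (intro cINF_greatest) auto
qed

section \<open>Consequences of the integrability of the weight\<close>

text \<open>
  The essential infimum cannot exceed the values taken on a set of positive measure, here the
  central half of the free cube.
\<close>

lemma ess_inf_dist_weight_le:
  fixes E :: "(real^'n) set"
  assumes ne: "E \<noteq> {}" and \<alpha>: "0 < \<alpha>" and r: "0 < r"
    and sub: "cube b r \<subseteq> P" and free: "E \<inter> cube b r = {}"
  shows "ess_inf_on P (dist_weight \<alpha> E) \<le> ennreal ((r / 4) powr - \<alpha>)"
  unfolding ess_inf_on_def
proof (rule Sup_least, safe)
  fix t assume t: "AE x in lebesgue. x \<in> P \<longrightarrow> t \<le> dist_weight \<alpha> E x"
  define K where "K = cube (\<chi> i. b $ i + r / 4) (r / 2)"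
  have K: "K \<in> lmeasurable" "measure lebesgue K > 0"
    using measure_cube[of "r / 2" "\<chi> i. b $ i + r / 4"] r by (simp_all add: K_def)
  have "K \<subseteq> cube b r"
  proof
    fix x assume x: "x \<in> K"
    have "b $ i \<le> x $ i \<and> x $ i < b $ i + r" for i
      using x r by (auto simp: K_def cube_def dest!: spec[of _ i])
    thus "x \<in> cube b r" by (simp add: cube_def)
  qed
  have "\<exists>x\<in>K. t \<le> dist_weight \<alpha> E x"
  proof (rule ccontr)
    assume "\<not> ?thesis"
    hence "AE x in lebesgue. x \<notin> K"
      using \<open>K \<subseteq> cube b r\<close> sub by (intro eventually_mono[OF t]) blast
    hence "K \<in> null_sets lebesgue"
      using K(1) by (subst AE_iff_null_sets) (auto dest: fmeasurableD)
    hence "measure lebesgue K = 0" by (simp add: measure_eq_0_null_sets)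
    thus False using K(2) by simp
  qed
  then obtain x where x: "x \<in> K" "t \<le> dist_weight \<alpha> E x" by blast
  have d: "r / 4 \<le> infdist x E"
    using infdist_ge_on_core[OF ne free] x(1) by (simp add: K_def)
  hence "dist_weight \<alpha> E x = ennreal (infdist x E powr - \<alpha>)"
    using r by (simp add: dist_weight_def)
  also have "\<dots> \<le> ennreal ((r / 4) powr - \<alpha>)"
    using d r \<alpha> by (intro ennreal_leI powr_mono2') auto
  finally show "t \<le> ennreal ((r / 4) powr - \<alpha>)" using x(2) by simp
qed

text \<open>
  Chebyshev's inequality for the weight at level \<open>\<eta>\<^sup>-\<^sup>\<alpha>\<close>, with the integral controlled by the
  \<open>A\<^sub>1\<close> condition and the free cube.
\<close>

lemma measure_near_le:
  fixes E :: "(real^'n) set"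
  assumes ne: "E \<noteq> {}" and \<alpha>: "0 < \<alpha>" and A1: "A1_bound (dist_weight \<alpha> E) C"
    and P: "is_cube P" and r: "0 < r" and sub: "cube b r \<subseteq> P" and free: "E \<inter> cube b r = {}"
    and \<eta>: "0 < \<eta>"
  shows "measure lebesgue {x \<in> P. infdist x E < \<eta>} \<le> C * (4 * \<eta> / r) powr \<alpha> * measure lebesgue P"
    and "{x \<in> P. infdist x E < \<eta>} \<in> lmeasurable"
proof -
  let ?w = "dist_weight \<alpha> E"
  define A where "A = {x \<in> P. infdist x E < \<eta>}"
  obtain a l where l: "0 < l" and Pa: "P = cube a l" using P by (auto simp: is_cube_def)
  have Pm: "P \<in> lmeasurable" and Ppos: "0 < measure lebesgue P"
    using measure_cube[OF l, of a] l by (simp_all add: Pa)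
  have C: "0 \<le> C" using A1 by (simp add: A1_bound_def)
  have "open {x. infdist x E < \<eta>}"
    by (intro open_Collect_less continuous_intros)
  hence "{x. infdist x E < \<eta>} \<in> sets lebesgue" by (simp add: borel_open sets_completionI_sets)
  hence "P \<inter> {x. infdist x E < \<eta>} \<in> lmeasurable"
    using Pm by (intro fmeasurable_Int_fmeasurable)
  moreover have "A = P \<inter> {x. infdist x E < \<eta>}" by (auto simp: A_def)
  ultimately have Am: "A \<in> lmeasurable" by simp
  thus "{x \<in> P. infdist x E < \<eta>} \<in> lmeasurable" by (simp add: A_def)
  have "ennreal (\<eta> powr - \<alpha>) * emeasure lebesgue A
      = (\<integral>\<^sup>+x. ennreal (\<eta> powr - \<alpha>) * indicator A x \<partial>lebesgue)"
    using Am by (simp add: nn_integral_cmult_indicator fmeasurableD)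
  also have "\<dots> \<le> (\<integral>\<^sup>+x\<in>P. ?w x \<partial>lebesgue)"
  proof (rule nn_integral_mono)
    fix x
    have "ennreal (\<eta> powr - \<alpha>) \<le> ?w x" if "x \<in> A"
      using that \<alpha> infdist_nonneg[of x E]
      by (auto simp: A_def dist_weight_def intro!: ennreal_leI powr_mono2')
    thus "ennreal (\<eta> powr - \<alpha>) * indicator A x \<le> ?w x * indicator P x"
      by (auto simp: indicator_def A_def)
  qed
  also have "\<dots> = (\<integral>\<^sup>+x\<in>P. ?w x \<partial>lebesgue) / emeasure lebesgue P * emeasure lebesgue P"
    using Ppos Pm
    by (subst ennreal_divide_times, subst ennreal_divide_self) (auto simp: emeasure_eq_measure2)
  also have "\<dots> \<le> ennreal C * ess_inf_on P ?w * emeasure lebesgue P"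
    using A1 P by (intro mult_right_mono) (auto simp: A1_bound_def)
  also have "\<dots> \<le> ennreal C * ennreal ((r / 4) powr - \<alpha>) * emeasure lebesgue P"
    using ess_inf_dist_weight_le[OF ne \<alpha> r sub free] by (intro mult_right_mono mult_left_mono) auto
  finally have "ennreal (\<eta> powr - \<alpha> * measure lebesgue A)
      \<le> ennreal (C * (r / 4) powr - \<alpha> * measure lebesgue P)"
    using C Am Pm by (simp add: emeasure_eq_measure2 ennreal_mult)
  hence "\<eta> powr - \<alpha> * measure lebesgue A \<le> C * (r / 4) powr - \<alpha> * measure lebesgue P"
    using C by (subst (asm) ennreal_le_iff) auto
  hence "\<eta> powr \<alpha> * (\<eta> powr - \<alpha> * measure lebesgue A)
      \<le> \<eta> powr \<alpha> * (C * (r / 4) powr - \<alpha> * measure lebesgue P)"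
    by (rule mult_left_mono) simp
  moreover have "\<eta> powr \<alpha> * \<eta> powr - \<alpha> = 1" using \<eta> by (simp add: powr_minus)
  moreover have "\<eta> powr \<alpha> * (r / 4) powr - \<alpha> = (4 * \<eta> / r) powr \<alpha>"
    using \<eta> r by (simp add: powr_minus powr_divide powr_mult field_simps)
  ultimately show "measure lebesgue {x \<in> P. infdist x E < \<eta>}
      \<le> C * (4 * \<eta> / r) powr \<alpha> * measure lebesgue P"
    unfolding A_def[symmetric] by (metis (no_types, opaque_lifting) mult.assoc mult.left_commute mult_1)
qed

text \<open>
  At a point of positive distance from \<open>E\<close>, all sufficiently small dyadic cubes around it are
  \<open>E\<close>-free.  If there are none, the distance vanishes throughout \<open>P\<close>, and an infinite weight on a
  set of positive measure is not locally integrable.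
\<close>

lemma exists_free_dyadic:
  fixes E :: "(real^'n) set"
  assumes w: "weight (dist_weight \<alpha> E)" and P: "is_cube P"
  shows "free_dyadic E P \<noteq> {}"
proof
  assume none: "free_dyadic E P = {}"
  let ?w = "dist_weight \<alpha> E"
  obtain a l where l: "0 < l" and Pa: "P = cube a l" using P by (auto simp: is_cube_def)
  have "infdist x E = 0" if x: "x \<in> P" for x
  proof (rule ccontr)
    assume "infdist x E \<noteq> 0"
    hence pos: "0 < infdist x E" using infdist_nonneg[of x E] by linarith
    have "(\<lambda>j. real CARD('n) * l * (1 / 2) ^ j) \<longlonglongrightarrow> real CARD('n) * l * 0"
      by (intro tendsto_mult tendsto_const LIMSEQ_power_zero) simp
    hence "\<forall>\<^sub>F j in sequentially. real CARD('n) * l * (1 / 2) ^ j < infdist x E"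
      using pos by (intro order_tendstoD) auto
    then obtain j where "real CARD('n) * l * (1 / 2) ^ j < infdist x E"
      by (auto simp: eventually_sequentially)
    hence j: "real CARD('n) * (l / 2 ^ j) \<le> infdist x E"
      by (simp add: power_divide)
    obtain Q where Q: "Q \<in> dyadic_level j P" "x \<in> Q"
      using Union_dyadic_level[OF P, of j] x by blast
    then obtain b where "Q = cube b (l / 2 ^ j)"
      unfolding Pa dyadic_level_cube[OF l] by blast
    hence "E \<inter> Q = {}" using free_cube_if_far_point j Q(2) by blast
    thus False using none Q(1) by (auto simp: free_dyadic_def dyadic_def)
  qed
  hence inf: "?w x = \<infinity>" if "x \<in> P" for x using that by (simp add: dist_weight_def)
  let ?K = "cbox a (\<chi> i. a $ i + l)"
  have "P \<subseteq> ?K" by (auto simp: Pa cube_def mem_box_cart less_imp_le)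
  have "\<infinity> * emeasure lebesgue P = (\<integral>\<^sup>+x. \<infinity> * indicator P x \<partial>lebesgue)"
    using measure_cube(2)[OF l, of a] by (simp add: Pa fmeasurableD nn_integral_cmult_indicator)
  also have "\<dots> \<le> (\<integral>\<^sup>+x\<in>?K. ?w x \<partial>lebesgue)"
    using \<open>P \<subseteq> ?K\<close> inf by (intro nn_integral_mono) (auto simp: indicator_def)
  also have "\<dots> < \<infinity>" using w by (simp add: weight_def)
  finally have "\<infinity> * emeasure lebesgue P < \<infinity>" .
  moreover have "0 < emeasure lebesgue P"
    using measure_cube[OF l, of a] l by (simp add: Pa emeasure_eq_measure2)
  ultimately show False by (auto simp: ennreal_top_mult split: if_splits)
qed

section \<open>Weak porosity\<close>

text \<open>
  The choice of \<open>k\<close> refers only to the numbers \<open>C\<close>, \<open>K\<close> and \<open>\<alpha>\<close>, which is what keeps the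
  porosity constants independent of the set.
\<close>

lemma exists_small_dyadic_scale:
  fixes C K \<alpha> :: real
  assumes "0 < \<alpha>" "0 \<le> K"
  shows "\<exists>k\<ge>1. C * (K / 2 ^ k) powr \<alpha> \<le> 1 / 2"
proof -
  have "(\<lambda>k. C * (K * (1 / 2) ^ k) powr \<alpha>) \<longlonglongrightarrow> C * (K * 0) powr \<alpha>"
    using assms
    by (intro tendsto_mult tendsto_powr2 tendsto_const LIMSEQ_power_zero) auto
  hence "\<forall>\<^sub>F k in sequentially. C * (K * (1 / 2) ^ k) powr \<alpha> < 1 / 2"
    using assms by (intro order_tendstoD) auto
  hence "\<forall>\<^sub>F k in sequentially. C * (K * (1 / 2) ^ k) powr \<alpha> < 1 / 2 \<and> 1 \<le> k"
    by (intro eventually_conj eventually_ge_at_top)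
  then obtain k where "C * (K * (1 / 2) ^ k) powr \<alpha> < 1 / 2 \<and> 1 \<le> k"
    using eventually_happens'[OF sequentially_bot] by fast
  thus ?thesis by (intro exI[of _ k]) (simp add: power_divide)
qed

text \<open>
  Every point of \<open>P\<close> that is not near \<open>E\<close> lies in a free cube of the level, so the near points
  together with the free cubes cover \<open>P\<close>.
\<close>

lemma measure_far_le_free_dyadic:
  fixes E :: "(real^'n) set"
  assumes l: "0 < l" and P: "P = cube a l"
    and near: "{x \<in> P. infdist x E < real CARD('n) * (l / 2 ^ i)} \<in> lmeasurable"
  defines "G \<equiv> {Q \<in> dyadic_level i P. E \<inter> Q = {}}"
  shows "measure lebesgue P - measure lebesgue {x \<in> P. infdist x E < real CARD('n) * (l / 2 ^ i)}
    \<le> (\<Sum>Q\<in>G. measure lebesgue Q)"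
proof -
  let ?A = "{x \<in> P. infdist x E < real CARD('n) * (l / 2 ^ i)}"
  have c: "is_cube P" using l P by (auto simp: is_cube_def)
  have lev: "\<exists>b. Q = cube b (l / 2 ^ i)" if "Q \<in> dyadic_level i P" for Q
    using that unfolding P dyadic_level_cube[OF l] by blast
  have lm: "Q \<in> lmeasurable" if "Q \<in> dyadic_level i P" for Q
    using lev[OF that] l measure_cube(2)[of "l / 2 ^ i"] by auto
  have fin: "finite G"
  proof -
    have "0 < card (dyadic_level i P)" using card_dyadic_level[OF c, of i] by simp
    hence "finite (dyadic_level i P)" by (rule card_ge_0_finite)
    thus ?thesis by (simp add: G_def)
  qed
  have cover: "P \<subseteq> ?A \<union> \<Union>G"
  proof
    fix x assume x: "x \<in> P"
    obtain Q where Q: "Q \<in> dyadic_level i P" "x \<in> Q"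
      using Union_dyadic_level[OF c, of i] x by blast
    have "E \<inter> Q = {}" if "\<not> infdist x E < real CARD('n) * (l / 2 ^ i)"
      using lev[OF Q(1)] Q(2) that free_cube_if_far_point[of x _ "l / 2 ^ i" E]
      by (auto simp: not_less)
    thus "x \<in> ?A \<union> \<Union>G" using x Q by (auto simp: G_def)
  qed
  have UG: "\<Union>G \<in> lmeasurable"
    using fin lm by (intro fmeasurable.finite_Union) (auto simp: G_def)
  have "measure lebesgue P \<le> measure lebesgue (?A \<union> \<Union>G)"
    using cover near UG measure_cube(2)[OF l, of a]
    by (intro measure_mono_fmeasurable fmeasurable.Un) (auto simp: P dest: fmeasurableD)
  also have "\<dots> \<le> measure lebesgue ?A + measure lebesgue (\<Union>G)"
    using near UG by (intro measure_Un_le) (auto dest: fmeasurableD)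
  also have "measure lebesgue (\<Union>G) \<le> (\<Sum>Q\<in>G. measure lebesgue Q)"
    using fin lm measure_UNION_le[of G "\<lambda>Q. Q" lebesgue]
    by (auto simp: G_def dest: fmeasurableD)
  finally show ?thesis by simp
qed

lemma weakly_porous_if_A1_bound:
  fixes E :: "(real^'n) set"
  assumes ne: "E \<noteq> {}" and \<alpha>: "0 < \<alpha>" and w: "weight (dist_weight \<alpha> E)"
    and A1: "A1_bound (dist_weight \<alpha> E) C"
    and k: "1 \<le> k" "C * (4 * real CARD('n) / 2 ^ k) powr \<alpha> \<le> 1 / 2"
  shows "weakly_porous (1 / 2) ((1 / 2 ^ k) ^ CARD('n)) E"
  unfolding weakly_porous_def
proof (intro conjI allI impI)
  have "(1::real) / 2 ^ k < 1" using k(1) by simp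
  thus "(1 / 2 ^ k :: real) ^ CARD('n) < 1" by (intro power_less_one_iff[THEN iffD2]) auto
next
  fix P :: "(real^'n) set" assume P: "is_cube P"
  then obtain a l where l: "0 < l" and Pa: "P = cube a l" by (auto simp: is_cube_def)
  define M where "M = max_free E P"
  have "M \<in> free_dyadic E P"
    using max_free(1)[OF P exists_free_dyadic[OF w P]] by (simp add: M_def)
  then obtain j where j: "M \<in> dyadic_level j P" and Mfree: "E \<inter> M = {}"
    by (auto simp: free_dyadic_def dyadic_def)
  define r where "r = l / 2 ^ j"
  have r: "0 < r" using l by (simp add: r_def)
  obtain b where M: "M = cube b r"
    using j unfolding Pa dyadic_level_cube[OF l] r_def by blast
  have MP: "M \<subseteq> P" using Union_dyadic_level[OF P, of j] j by blast
  \<comment> \<open>The cubes to be collected lie \<open>k\<close> generations below the largest free one.\<close>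
  define s where "s = l / 2 ^ (j + k)"
  have s: "0 < s" "s = r / 2 ^ k" using l by (simp_all add: s_def r_def power_add)
  define A where "A = {x \<in> P. infdist x E < real CARD('n) * s}"
  note near = measure_near_le[OF ne \<alpha> A1 P r, of b "real CARD('n) * s", folded A_def M, OF MP Mfree]
  have "measure lebesgue A \<le> C * (4 * (real CARD('n) * s) / r) powr \<alpha> * measure lebesgue P"
    using near(1) s(1) by simp
  also have "4 * (real CARD('n) * s) / r = 4 * real CARD('n) / 2 ^ k"
    using r by (simp add: s(2) field_simps)
  also have "C * (4 * real CARD('n) / 2 ^ k) powr \<alpha> * measure lebesgue P \<le> 1 / 2 * measure lebesgue P"
    using k(2) by (intro mult_right_mono) auto
  finally have A: "measure lebesgue A \<le> 1 / 2 * measure lebesgue P" .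
  have Am: "A \<in> lmeasurable" using near(2) s(1) by simp
  define G where "G = {Q \<in> dyadic_level (j + k) P. E \<inter> Q = {}}"
  have G: "1 / 2 * measure lebesgue P \<le> (\<Sum>Q\<in>G. measure lebesgue Q)"
    using measure_far_le_free_dyadic[OF l Pa, of E "j + k"] Am A
    by (simp add: G_def A_def s_def)
  have "0 < measure lebesgue P" using measure_cube[OF l, of a] l by (simp add: Pa)
  \<comment> \<open>A sum over an empty or an infinite set is \<open>0\<close>, so positivity yields \<open>N \<ge> 1\<close> as well as
      finiteness.\<close>
  hence "(\<Sum>Q\<in>G. measure lebesgue Q) \<noteq> 0" using G by linarith
  hence finG: "finite G" and neG: "G \<noteq> {}" by (metis sum.infinite, metis sum.empty)
  obtain Q where Q: "bij_betw Q {1..card G} G"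
    using ex_bij_betw_nat_finite_1[OF finG] by blast
  have QG: "Q m \<in> G" if "m \<in> {1..card G}" for m using Q that by (auto simp: bij_betw_def)
  show "\<exists>(N::nat) Q. 1 \<le> N \<and>
           (\<forall>k\<in>{1..N}. Q k \<in> free_dyadic E P) \<and>
           disjoint_family_on Q {1..N} \<and>
           (\<forall>m\<in>{1..N}. (1 / 2 ^ k) ^ CARD('n) * measure lebesgue (max_free E P) \<le> measure lebesgue (Q m)) \<and>
           1 / 2 * measure lebesgue P \<le> (\<Sum>k=1..N. measure lebesgue (Q k))"
  proof (intro exI conjI ballI)
    show "1 \<le> card G" using finG neG by (simp add: Suc_le_eq card_gt_0_iff)
    show "Q m \<in> free_dyadic E P" if "m \<in> {1..card G}" for m
      using QG[OF that] by (auto simp: G_def free_dyadic_def dyadic_def)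
    show "disjoint_family_on Q {1..card G}"
      unfolding disjoint_family_on_def
    proof (intro ballI impI)
      fix m m' assume m: "m \<in> {1..card G}" "m' \<in> {1..card G}" "m \<noteq> m'"
      have "Q m \<noteq> Q m'"
        using bij_betw_imp_inj_on[OF Q] m by (simp add: inj_on_eq_iff)
      moreover have "Q m \<in> dyadic_level (j + k) P" "Q m' \<in> dyadic_level (j + k) P"
        using QG[OF m(1)] QG[OF m(2)] by (simp_all add: G_def)
      ultimately have "disjnt (Q m) (Q m')"
        using disjoint_dyadic_level[OF P, of "j + k"] by (simp add: pairwiseD)
      thus "Q m \<inter> Q m' = {}" by (simp add: disjnt_def)
    qed
    show "(1 / 2 ^ k) ^ CARD('n) * measure lebesgue (max_free E P) \<le> measure lebesgue (Q m)"
      if "m \<in> {1..card G}" for m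
    proof -
      have "Q m \<in> G" using QG that by blast
      then obtain q where "Q m = cube q s"
        unfolding G_def Pa dyadic_level_cube[OF l] s_def by blast
      hence "measure lebesgue (Q m) = s ^ CARD('n)" using s(1) by (simp add: measure_cube)
      moreover have "measure lebesgue (max_free E P) = r ^ CARD('n)"
        using r M by (simp add: measure_cube M_def)
      ultimately show ?thesis by (simp add: s(2) power_mult_distrib[symmetric])
    qed
    show "1 / 2 * measure lebesgue P \<le> (\<Sum>m=1..card G. measure lebesgue (Q m))"
      using G sum.reindex_bij_betw[OF Q, of "measure lebesgue"] by simp
  qed
qed auto

theorem lemma4p1:
  shows "\<exists>c \<delta> :: real \<Rightarrow> real \<Rightarrow> real. \<forall>(E :: (real^'n) set) (\<alpha> :: real). E \<noteq> {} \<longrightarrow> 0 < \<alpha> \<longrightarrow>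
    (let w = dist_weight \<alpha> E in
       A1 w \<longrightarrow> weakly_porous (c \<alpha> (A1_const w)) (\<delta> \<alpha> (A1_const w)) E)"
proof -
  have "\<exists>k. 0 < \<alpha> \<longrightarrow> 1 \<le> k \<and> C * (4 * real CARD('n) / 2 ^ k) powr \<alpha> \<le> 1 / 2"
    for \<alpha> C :: real
    using exists_small_dyadic_scale[of \<alpha> "4 * real CARD('n)" C] by auto
  then obtain k where k: "\<And>\<alpha> C. 0 < \<alpha> \<Longrightarrow> 1 \<le> k \<alpha> C"
      "\<And>\<alpha> C. 0 < \<alpha> \<Longrightarrow> C * (4 * real CARD('n) / 2 ^ k \<alpha> C) powr \<alpha> \<le> 1 / 2"
    by metis
  define \<delta> :: "real \<Rightarrow> real \<Rightarrow> real" where "\<delta> \<alpha> C = (1 / 2 ^ k \<alpha> C) ^ CARD('n)" for \<alpha> C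
  have porous: "weakly_porous (1 / 2) (\<delta> \<alpha> (A1_const (dist_weight \<alpha> E))) E"
    if "E \<noteq> {}" "0 < \<alpha>" and w: "A1 (dist_weight \<alpha> E)" for E :: "(real^'n) set" and \<alpha>
  proof -
    have "weight (dist_weight \<alpha> E)" using w by (simp add: A1_def)
    from weakly_porous_if_A1_bound[OF that(1,2) this A1_const_least(1)[OF w] k(1)[OF that(2)] k(2)[OF that(2)]]
    show ?thesis by (simp add: \<delta>_def)
  qed
  show ?thesis
    unfolding Let_def
    by (rule exI[where x = "\<lambda>_ _. 1 / 2"], rule exI[where x = \<delta>]) (intro allI impI porous)
qed

end
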